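(* Let $X$ be a complex Banach space, let $m \geq 1$ be an integer, and let $\varphi : X \to X$ be a continuous linear mapping. If the composition operator $C_\varphi : \mathcal{P}(^m X)_{\tau_0} \to \mathcal{P}(^m X)_{\tau_0}$, $C_\varphi(p) = p \circ \varphi$, is power bounded, then it is uniformly mean ergodic.
   Context: An $m$-homogeneous polynomial $p : X \to \mathbb{C}$ is a mapping of the form $p(x) = L(x, \ldots, x)$ with $L : X \times \cdots \times X \to \mathbb{C}$ a continuous $m$-linear form; $\mathcal{P}(^m X)$ denotes the vector space of all of them, and $\mathcal{P}(^m X)_{\tau_0}$ is this space endowed with the compact-open topology $\tau_0$, i.e. the topology of uniform convergence on the compact subsets of $X$. Let $E$ be a locally convex Hausdorff space, $L(E)$ the space of continuous linear operators $E \to E$, and $T \in L(E)$. $T$ is power bounded if the sequence of iterates $(T^n)_{n \in \mathbb{N}}$ is equicontinuous. The Cesàro means of $T$ are $T_{[n]} := \frac{1}{n} \sum_{k=0}^{n-1} T^k$, $n \in \mathbb{N}$. $T$ is uniformly mean ergodic if $(T_{[n]})_{n}$ converges to some operator $S \in L(E)$ in the topology of uniform convergence on the bounded subsets of $E$. *)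

theory Defs
  imports "HOL-Analysis.Analysis" "HOL-Library.Function_Algebras"
begin

section \<open>Complex vector spaces and complex Banach spaces\<close>

class scaleC =
  fixes scaleC :: "complex \<Rightarrow> 'a \<Rightarrow> 'a"  (infixr "*\<^sub>C" 75)

class complex_vector = scaleC + ab_group_add +
  assumes scaleC_add_right: "a *\<^sub>C (x + y) = a *\<^sub>C x + a *\<^sub>C y"
    and scaleC_add_left: "(a + b) *\<^sub>C x = a *\<^sub>C x + b *\<^sub>C x"
    and scaleC_scaleC: "a *\<^sub>C (b *\<^sub>C x) = (a * b) *\<^sub>C x"
    and scaleC_one: "1 *\<^sub>C x = x"

global_interpretation complex_vector: vector_space "scaleC :: complex \<Rightarrow> 'a \<Rightarrow> 'a::complex_vector"
  by unfold_locales (rule scaleC_add_right scaleC_add_left scaleC_scaleC scaleC_one)+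

class complex_banach = banach + complex_vector +
  assumes scaleC_of_real: "of_real r *\<^sub>C x = r *\<^sub>R x"
    and norm_scaleC: "norm (a *\<^sub>C x) = norm a * norm x"

instantiation complex :: complex_banach
begin

definition scaleC_complex :: "complex \<Rightarrow> complex \<Rightarrow> complex" where
  "scaleC_complex a x = a * x"

instance
  by standard (simp_all add: scaleC_complex_def algebra_simps norm_mult scaleR_conv_of_real)

end

instantiation "fun" :: (type, complex_vector) complex_vector
begin

definition scaleC_fun :: "complex \<Rightarrow> ('a \<Rightarrow> 'b) \<Rightarrow> 'a \<Rightarrow> 'b" where
  "scaleC_fun a f = (\<lambda>x. a *\<^sub>C f x)"

instance
  by standard (simp_all add: scaleC_fun_def fun_eq_iff scaleC_add_right scaleC_add_left
      scaleC_scaleC scaleC_one)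

end

section \<open>Operators on topological vector spaces\<close>

text \<open>
  A topological vector space \<open>E\<close> is given by its topology, an element of \<^typ>\<open>'e topology\<close> for some
  \<open>'e :: complex_vector\<close>; the underlying vector space is the linear subspace \<open>topspace E\<close> of \<open>'e\<close>.
  An operator on \<open>E\<close> is a map on \<open>'e\<close> of which only the restriction to \<open>topspace E\<close> matters.
\<close>

definition zero_nhds :: "'e::complex_vector topology \<Rightarrow> 'e set set" where
  "zero_nhds E = {V. openin E V \<and> 0 \<in> V}"

definition continuous_operators :: "'e::complex_vector topology \<Rightarrow> ('e \<Rightarrow> 'e) set" where
  "continuous_operators E = {T. continuous_map E E T \<and>
     (\<forall>x\<in>topspace E. \<forall>y\<in>topspace E. T (x + y) = T x + T y) \<and>
     (\<forall>c. \<forall>x\<in>topspace E. T (c *\<^sub>C x) = c *\<^sub>C T x)}"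

definition equicontinuous :: "'e::complex_vector topology \<Rightarrow> ('e \<Rightarrow> 'e) set \<Rightarrow> bool" where
  "equicontinuous E F \<longleftrightarrow> (\<forall>x\<in>topspace E. \<forall>V\<in>zero_nhds E.
     \<exists>U. openin E U \<and> x \<in> U \<and> (\<forall>T\<in>F. \<forall>y\<in>U. T y - T x \<in> V))"

definition power_bounded :: "'e::complex_vector topology \<Rightarrow> ('e \<Rightarrow> 'e) \<Rightarrow> bool" where
  "power_bounded E T \<longleftrightarrow> equicontinuous E (range (\<lambda>n::nat. T ^^ n))"

definition cesaro_mean :: "('e::complex_vector \<Rightarrow> 'e) \<Rightarrow> nat \<Rightarrow> 'e \<Rightarrow> 'e" where
  "cesaro_mean T n x = (1 / of_nat n) *\<^sub>C (\<Sum>k<n. (T ^^ k) x)"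

definition tvs_bounded :: "'e::complex_vector topology \<Rightarrow> 'e set \<Rightarrow> bool" where
  "tvs_bounded E B \<longleftrightarrow> B \<subseteq> topspace E \<and>
     (\<forall>V\<in>zero_nhds E. \<exists>r>0. \<forall>c. norm c \<ge> r \<longrightarrow> B \<subseteq> (\<lambda>x. c *\<^sub>C x) ` V)"

definition converges_bounded_uniformly ::
    "'e::complex_vector topology \<Rightarrow> (nat \<Rightarrow> 'e \<Rightarrow> 'e) \<Rightarrow> ('e \<Rightarrow> 'e) \<Rightarrow> bool" where
  "converges_bounded_uniformly E A S \<longleftrightarrow> (\<forall>B. tvs_bounded E B \<longrightarrow>
     (\<forall>V\<in>zero_nhds E. \<forall>\<^sub>F n in sequentially. \<forall>x\<in>B. A n x - S x \<in> V))"

definition uniformly_mean_ergodic :: "'e::complex_vector topology \<Rightarrow> ('e \<Rightarrow> 'e) \<Rightarrow> bool" where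
  "uniformly_mean_ergodic E T \<longleftrightarrow>
     (\<exists>S\<in>continuous_operators E. converges_bounded_uniformly E (cesaro_mean T) S)"

section \<open>Homogeneous polynomials and the compact-open topology\<close>

text \<open>
  The power \<open>X\<^sup>m\<close> is the set \<open>{..<m} \<rightarrow>\<^sub>E UNIV\<close> of families indexed by \<open>{..<m}\<close>,
  with the product topology.
\<close>

definition continuous_multilinear :: "nat \<Rightarrow> ((nat \<Rightarrow> 'a::complex_banach) \<Rightarrow> complex) \<Rightarrow> bool" where
  "continuous_multilinear m L \<longleftrightarrow>
     continuous_map (product_topology (\<lambda>_. euclidean) {..<m}) euclidean L \<and>
     (\<forall>x \<in> {..<m} \<rightarrow>\<^sub>E UNIV. \<forall>i<m.
        (\<forall>u v. L (x(i := u + v)) = L (x(i := u)) + L (x(i := v))) \<and>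
        (\<forall>c u. L (x(i := c *\<^sub>C u)) = c * L (x(i := u))))"

definition hom_polys :: "nat \<Rightarrow> ('a::complex_banach \<Rightarrow> complex) set" where
  "hom_polys m = {p. \<exists>L. continuous_multilinear m L \<and> (\<forall>x. p x = L (\<lambda>i\<in>{..<m}. x))}"

definition compact_open_topology ::
    "('a::topological_space \<Rightarrow> 'b::metric_space) set \<Rightarrow> ('a \<Rightarrow> 'b) topology" where
  "compact_open_topology F = topology (\<lambda>U. U \<subseteq> F \<and>
     (\<forall>p\<in>U. \<exists>K e. compact K \<and> e > 0 \<and> {q \<in> F. \<forall>x\<in>K. dist (q x) (p x) < e} \<subseteq> U))"

definition hom_poly_space :: "nat \<Rightarrow> ('a::complex_banach \<Rightarrow> complex) topology" where
  "hom_poly_space m = compact_open_topology (hom_polys m)"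

definition composition_operator :: "('a \<Rightarrow> 'a) \<Rightarrow> ('a \<Rightarrow> complex) \<Rightarrow> 'a \<Rightarrow> complex" where
  "composition_operator \<phi> p = p \<circ> \<phi>"

section \<open>Well-definedness\<close>

lemma openin_compact_open_topology:
  "openin (compact_open_topology F) U \<longleftrightarrow> U \<subseteq> F \<and>
     (\<forall>p\<in>U. \<exists>K e. compact K \<and> e > 0 \<and> {q \<in> F. \<forall>x\<in>K. dist (q x) (p x) < e} \<subseteq> U)"
proof -
  let ?N = "\<lambda>p K e. {q \<in> F. \<forall>x\<in>K. dist (q x) (p x) < e}"
  let ?P = "\<lambda>U. U \<subseteq> F \<and> (\<forall>p\<in>U. \<exists>K e. compact K \<and> e > 0 \<and> ?N p K e \<subseteq> U)"
  have "?P (S \<inter> T)" if S: "?P S" and T: "?P T" for S T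
  proof (intro conjI ballI)
    show "S \<inter> T \<subseteq> F" using S by blast
    fix p assume p: "p \<in> S \<inter> T"
    obtain K e where 1: "compact K" "e > 0" "?N p K e \<subseteq> S"
      using bspec[OF conjunct2[OF S] IntD1[OF p]] by (elim exE conjE)
    obtain K' e' where 2: "compact K'" "e' > 0" "?N p K' e' \<subseteq> T"
      using bspec[OF conjunct2[OF T] IntD2[OF p]] by (elim exE conjE)
    have "?N p (K \<union> K') (min e e') \<subseteq> ?N p K e \<inter> ?N p K' e'" by auto
    then have "?N p (K \<union> K') (min e e') \<subseteq> S \<inter> T" using 1(3) 2(3) by blast
    moreover have "compact (K \<union> K')" "min e e' > 0" using 1 2 by auto
    ultimately show "\<exists>K e. compact K \<and> e > 0 \<and> ?N p K e \<subseteq> S \<inter> T" by (intro exI conjI)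
  qed
  moreover have "?P (\<Union>\<K>)" if all: "\<forall>U\<in>\<K>. ?P U" for \<K>
  proof (intro conjI ballI)
    show "\<Union>\<K> \<subseteq> F" using all by blast
    fix p assume "p \<in> \<Union>\<K>"
    then obtain U where U: "U \<in> \<K>" "p \<in> U" by blast
    obtain K e where "compact K" "e > 0" "?N p K e \<subseteq> U"
      using bspec[OF conjunct2[OF bspec[OF all U(1)]] U(2)] by (elim exE conjE)
    moreover from this have "?N p K e \<subseteq> \<Union>\<K>" using U(1) by (intro order_trans[OF _ Union_upper])
    ultimately show "\<exists>K e. compact K \<and> e > 0 \<and> ?N p K e \<subseteq> \<Union>\<K>" by (intro exI conjI)
  qed
  ultimately have "istopology ?P" unfolding istopology_def by simp
  then show ?thesis
    unfolding compact_open_topology_def by (simp add: topology_inverse')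
qed

lemma topspace_compact_open_topology [simp]: "topspace (compact_open_topology F) = F"
proof -
  have "openin (compact_open_topology F) F"
    unfolding openin_compact_open_topology using compact_empty zero_less_one by blast
  then show ?thesis
    by (metis openin_compact_open_topology openin_topspace openin_subset subset_antisym)
qed

lemma topspace_hom_poly_space [simp]: "topspace (hom_poly_space m) = hom_polys m"
  by (simp add: hom_poly_space_def)

lemma subspace_hom_polys: "complex_vector.subspace (hom_polys m)"
proof (rule complex_vector.subspaceI)
  have "continuous_multilinear m (\<lambda>_. 0)"
    by (simp add: continuous_multilinear_def)
  then show "0 \<in> hom_polys m" by (auto simp: hom_polys_def)
next
  fix p q :: "'a \<Rightarrow> complex" assume "p \<in> hom_polys m" "q \<in> hom_polys m"
  then obtain L M where L: "continuous_multilinear m L" "\<And>x. p x = L (\<lambda>i\<in>{..<m}. x)"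
    and M: "continuous_multilinear m M" "\<And>x. q x = M (\<lambda>i\<in>{..<m}. x)"
    by (auto simp: hom_polys_def)
  have "continuous_multilinear m (\<lambda>x. L x + M x)"
    using L(1) M(1) unfolding continuous_multilinear_def
    by (auto intro: continuous_map_add simp: algebra_simps)
  then show "p + q \<in> hom_polys m" using L(2) M(2) by (auto simp: hom_polys_def)
next
  fix c :: complex and p :: "'a \<Rightarrow> complex" assume "p \<in> hom_polys m"
  then obtain L where L: "continuous_multilinear m L" "\<And>x. p x = L (\<lambda>i\<in>{..<m}. x)"
    by (auto simp: hom_polys_def)
  have "continuous_map euclidean euclidean (\<lambda>z. c * z)"
    by (simp add: continuous_on_mult_left)
  then have "continuous_map (product_topology (\<lambda>_. euclidean) {..<m}) euclidean (\<lambda>x. c * L x)"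
    using L(1) continuous_map_compose[of _ euclidean L euclidean "\<lambda>z. c * z"]
    unfolding continuous_multilinear_def by (simp add: o_def)
  then have "continuous_multilinear m (\<lambda>x. c * L x)"
    using L(1) unfolding continuous_multilinear_def by (simp add: algebra_simps)
  then show "c *\<^sub>C p \<in> hom_polys m"
    using L(2) by (auto simp: hom_polys_def scaleC_fun_def scaleC_complex_def)
qed

lemma composition_operator_hom_polys:
  assumes lin: "Vector_Spaces.linear scaleC scaleC \<phi>" and cont: "continuous_on UNIV \<phi>"
    and p: "p \<in> hom_polys m"
  shows "composition_operator \<phi> p \<in> hom_polys m"
proof -
  interpret \<phi>: Vector_Spaces.linear scaleC scaleC \<phi> by (rule lin)
  obtain L where L: "continuous_multilinear m L" "\<And>x. p x = L (\<lambda>i\<in>{..<m}. x)"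
    using p by (auto simp: hom_polys_def)
  let ?f = "\<lambda>x. \<lambda>i\<in>{..<m}. \<phi> (x i)"
  let ?X = "product_topology (\<lambda>_. euclidean) {..<m} :: (nat \<Rightarrow> 'a) topology"
  have comp: "continuous_map ?X euclidean (\<lambda>x. \<phi> (x i))" if "i < m" for i
    using continuous_map_compose[OF continuous_map_product_projection[of i "{..<m}"],
        of "\<lambda>_. euclidean" euclidean \<phi>] that cont
    by (simp add: o_def)
  have "continuous_map ?X ?X ?f"
    using comp by (auto simp: continuous_map_componentwise)
  then have "continuous_map ?X euclidean (L \<circ> ?f)"
    using L(1) continuous_map_compose unfolding continuous_multilinear_def by blast
  moreover have upd: "?f (x(i := u)) = (?f x)(i := \<phi> u)" if "i < m" for x i u
    using that by (auto simp: fun_eq_iff restrict_def)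
  moreover have "?f x \<in> {..<m} \<rightarrow>\<^sub>E UNIV" for x by simp
  ultimately have "continuous_multilinear m (L \<circ> ?f)"
    using L(1) unfolding continuous_multilinear_def by (simp add: upd \<phi>.add \<phi>.scale)
  moreover have "(p \<circ> \<phi>) x = (L \<circ> ?f) (\<lambda>i\<in>{..<m}. x)" for x
    by (simp add: L(2) cong: restrict_cong)
  ultimately show ?thesis
    unfolding composition_operator_def hom_polys_def by blast
qed

lemma composition_operator_continuous:
  assumes lin: "Vector_Spaces.linear scaleC scaleC \<phi>" and cont: "continuous_on UNIV \<phi>"
  shows "composition_operator (\<phi> :: 'a::complex_banach \<Rightarrow> 'a) \<in> continuous_operators (hom_poly_space m)"
proof -
  note maps = composition_operator_hom_polys[OF lin cont, of _ m]
  have "continuous_map (hom_poly_space m) (hom_poly_space m) (composition_operator \<phi>)"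
    unfolding continuous_map_def topspace_hom_poly_space
  proof (intro conjI allI impI)
    show "composition_operator \<phi> \<in> hom_polys m \<rightarrow> hom_polys m" using maps by blast
    fix U :: "('a \<Rightarrow> complex) set" assume U: "openin (hom_poly_space m) U"
    show "openin (hom_poly_space m) {p \<in> hom_polys m. composition_operator \<phi> p \<in> U}"
      unfolding hom_poly_space_def openin_compact_open_topology
    proof (intro conjI ballI)
      fix p assume "p \<in> {p \<in> hom_polys m. composition_operator \<phi> p \<in> U}"
      then obtain K e where K: "compact K" "e > 0"
        "{q \<in> hom_polys m. \<forall>x\<in>K. dist (q x) (composition_operator \<phi> p x) < e} \<subseteq> U"
        using U unfolding hom_poly_space_def openin_compact_open_topology by blast
      have "compact (\<phi> ` K)"
        using K(1) cont by (meson compact_continuous_image continuous_on_subset subset_UNIV)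
      moreover have "{q \<in> hom_polys m. \<forall>x\<in>\<phi> ` K. dist (q x) (p x) < e}
          \<subseteq> {p \<in> hom_polys m. composition_operator \<phi> p \<in> U}"
        using K(3) maps by (auto simp: composition_operator_def)
      ultimately show "\<exists>K e. compact K \<and> e > 0 \<and>
          {q \<in> hom_polys m. \<forall>x\<in>K. dist (q x) (p x) < e}
            \<subseteq> {p \<in> hom_polys m. composition_operator \<phi> p \<in> U}"
        using K(2) by blast
    qed simp
  qed
  then show ?thesis
    by (auto simp: continuous_operators_def composition_operator_def scaleC_fun_def fun_eq_iff)
qed

end

theory Submission
  imports Defs "HOL-Complex_Analysis.Conformal_Mappings"
begin

text \<open>
  Bounded sets in the space of polynomials are precompact, and for operators with precompact orbits
  power boundedness forces convergence of the means. In detail: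

  A set \<open>B\<close> of \<open>m\<close>-homogeneous polynomials that is bounded uniformly on compact sets is bounded
  uniformly on balls, since by homogeneity unboundedness on a ball would show up on a null sequence
  (\<open>tvs_bounded_imp_bounded_on_balls\<close>). Polynomials are holomorphic on complex lines, so \<open>B\<close> is
  equicontinuous by the Schwarz lemma (\<open>hom_poly_lipschitz\<close>), and on every compact set finitely many
  elements of \<open>B\<close> approximate all of them uniformly (\<open>tvs_bounded_imp_finite_net\<close>).

  Power boundedness says that for compact \<open>K\<close> there is a compact \<open>K'\<close> such that smallness of \<open>p\<close> on
  \<open>K'\<close> implies smallness on \<open>K\<close> of all \<open>p \<circ> \<phi> ^^ k\<close> simultaneously. Orbits are therefore bounded, and
  a finite net of the orbit of \<open>p\<close> on \<open>K'\<close> shows that the sequences \<open>k \<mapsto> p ((\<phi> ^^ k) x)\<close>, \<open>x \<in> K\<close>,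
  are almost periodic: up to a uniformly small error, they have only finitely many shifts.
  Such sequences have convergent means (\<open>uniformly_Cauchy_on_means\<close>), so that the Cesaro means of
  \<open>p\<close> converge uniformly on compact sets.

  The limit \<open>S p\<close> is again an \<open>m\<close>-homogeneous polynomial, because the polarization identity recovers
  the symmetric multilinear form of a polynomial from finitely many values of it, and so carries
  multilinearity over to the limit (\<open>hom_polys_pointwise_limit\<close>). Finally the means are equicontinuous
  operators. This makes \<open>S\<close> continuous and reduces uniform convergence on a bounded set to
  convergence on a finite net.
\<close>

section \<open>Multilinear forms and polarization\<close>

lemma continuous_multilinear_add:
  assumes "continuous_multilinear m L" "x \<in> {..<m} \<rightarrow>\<^sub>E UNIV" "i < m"
  shows "L (x(i := u + v)) = L (x(i := u)) + L (x(i := v))"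
  using assms unfolding continuous_multilinear_def by blast

lemma continuous_multilinear_scale:
  assumes "continuous_multilinear m L" "x \<in> {..<m} \<rightarrow>\<^sub>E UNIV" "i < m"
  shows "L (x(i := c *\<^sub>C u)) = c * L (x(i := u))"
  using assms unfolding continuous_multilinear_def by blast

lemma continuous_multilinear_sum:
  assumes L: "continuous_multilinear m L" "x \<in> {..<m} \<rightarrow>\<^sub>E UNIV" "i < m" and "finite A"
  shows "L (x(i := (\<Sum>j\<in>A. u j))) = (\<Sum>j\<in>A. L (x(i := u j)))"
  using \<open>finite A\<close>
proof induction
  case empty
  have "L (x(i := 0 *\<^sub>C 0)) = 0"
    by (subst continuous_multilinear_scale[OF L]) simp
  then show ?case by (simp del: fun_upd_apply)
next
  case (insert j A)
  then show ?case by (simp add: continuous_multilinear_add[OF L] del: fun_upd_apply)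
qed

text \<open>
  Statements about \<open>L\<close> on the diagonal are proved by treating one coordinate at a time: the first
  \<open>k\<close> coordinates have already been processed, the others are parameters. These two identities
  move coordinate \<open>k\<close> from the second group to the first one.
\<close>

lemma restrict_if_Suc:
  fixes f g :: "nat \<Rightarrow> 'a"
  assumes "k < m"
  shows "(\<lambda>i\<in>{..<m}. if i < Suc k then f i else g i) =
    (\<lambda>i\<in>{..<m}. if i < k then f i else g i)(k := f k)"
  using assms by (auto simp: fun_eq_iff restrict_def less_Suc_eq)

lemma restrict_if_upd:
  fixes f g :: "nat \<Rightarrow> 'a"
  assumes "k < m"
  shows "(\<lambda>i\<in>{..<m}. if i < k then f i else g i)(k := v) =
    (\<lambda>i\<in>{..<m}. if i < k then f i else (g(k := v)) i)"
  using assms by (auto simp: fun_eq_iff restrict_def)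

lemma continuous_multilinear_scale_all:
  assumes L: "continuous_multilinear m L" and "k \<le> m"
  shows "L (\<lambda>i\<in>{..<m}. if i < k then c *\<^sub>C u i else w i) =
    c ^ k * L (\<lambda>i\<in>{..<m}. if i < k then u i else w i)"
  using \<open>k \<le> m\<close>
proof (induction k arbitrary: w)
  case (Suc k)
  then have k: "k < m" by simp
  have "L (\<lambda>i\<in>{..<m}. if i < Suc k then c *\<^sub>C u i else w i) =
      c * L (\<lambda>i\<in>{..<m}. if i < k then c *\<^sub>C u i else (w(k := u k)) i)"
    unfolding restrict_if_Suc[OF k] restrict_if_upd[OF k, symmetric]
    by (rule continuous_multilinear_scale[OF L _ k]) simp
  also have "\<dots> = c * (c ^ k * L (\<lambda>i\<in>{..<m}. if i < k then u i else (w(k := u k)) i))"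
    using Suc by (simp only: Suc_leD)
  finally show ?case
    unfolding restrict_if_Suc[OF k] restrict_if_upd[OF k] by (simp only: power_Suc mult.assoc)
qed simp

lemma continuous_multilinear_holomorphic_on_lines:
  assumes L: "continuous_multilinear m L" and "k \<le> m"
  shows "(\<lambda>t. L (\<lambda>i\<in>{..<m}. if i < k then u i + t *\<^sub>C v i else w i)) holomorphic_on UNIV"
  using \<open>k \<le> m\<close>
proof (induction k arbitrary: w)
  case (Suc k)
  then have k: "k < m" by simp
  have "L (\<lambda>i\<in>{..<m}. if i < Suc k then u i + t *\<^sub>C v i else w i) =
      L (\<lambda>i\<in>{..<m}. if i < k then u i + t *\<^sub>C v i else (w(k := u k)) i) +
      t * L (\<lambda>i\<in>{..<m}. if i < k then u i + t *\<^sub>C v i else (w(k := v k)) i)" for t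
    unfolding restrict_if_Suc[OF k] restrict_if_upd[OF k, symmetric]
    by (subst continuous_multilinear_add[OF L _ k], simp)
      (subst continuous_multilinear_scale[OF L _ k], simp_all)
  then show ?case
    by (simp only:) (intro holomorphic_intros Suc.IH[OF Suc_leD[OF Suc.prems]])
qed simp

lemma continuous_multilinear_expand:
  assumes L: "continuous_multilinear m L" and "finite A" and "k \<le> m"
  shows "L (\<lambda>i\<in>{..<m}. if i < k then \<Sum>j\<in>A. x j else w i) =
    (\<Sum>f\<in>{..<k} \<rightarrow>\<^sub>E A. L (\<lambda>i\<in>{..<m}. if i < k then x (f i) else w i))"
  using \<open>k \<le> m\<close>
proof (induction k arbitrary: w)
  case (Suc k)
  then have k: "k < m" by simp
  have eq: "(\<lambda>i\<in>{..<m}. if i < k then x (f i) else (w(k := x j)) i) =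
      (\<lambda>i\<in>{..<m}. if i < Suc k then x ((f(k := j)) i) else w i)" for f j
    by (auto simp: fun_eq_iff restrict_def less_Suc_eq)
  have "L (\<lambda>i\<in>{..<m}. if i < Suc k then \<Sum>j\<in>A. x j else w i) =
      (\<Sum>j\<in>A. L (\<lambda>i\<in>{..<m}. if i < k then \<Sum>j\<in>A. x j else (w(k := x j)) i))"
    unfolding restrict_if_Suc[OF k] restrict_if_upd[OF k, symmetric]
    by (rule continuous_multilinear_sum[OF L _ k \<open>finite A\<close>]) simp
  also have "\<dots> = (\<Sum>j\<in>A. \<Sum>f\<in>{..<k} \<rightarrow>\<^sub>E A.
      L (\<lambda>i\<in>{..<m}. if i < k then x (f i) else (w(k := x j)) i))"
    by (simp only: Suc.IH[OF Suc_leD[OF Suc.prems]])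
  also have "\<dots> = (\<Sum>(j, f)\<in>A \<times> ({..<k} \<rightarrow>\<^sub>E A).
      L (\<lambda>i\<in>{..<m}. if i < Suc k then x ((f(k := j)) i) else w i))"
    unfolding eq by (simp only: sum.cartesian_product)
  also have "\<dots> = (\<Sum>f\<in>{..<Suc k} \<rightarrow>\<^sub>E A. L (\<lambda>i\<in>{..<m}. if i < Suc k then x (f i) else w i))"
    unfolding lessThan_Suc PiE_insert_eq
    using inj_combinator[of k "{..<k}" "\<lambda>_. A"]
    by (subst sum.reindex) (simp_all add: case_prod_unfold del: fun_upd_apply)
  finally show ?case .
qed simp

text \<open>
  For an \<open>m\<close>-homogeneous polynomial \<open>p\<close> this is, up to the factor \<open>m!\<close>, the symmetric \<open>m\<close>-linear form
  whose restriction to the diagonal is \<open>p\<close>.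
\<close>

definition polarization :: "nat \<Rightarrow> ('a::complex_banach \<Rightarrow> complex) \<Rightarrow> (nat \<Rightarrow> 'a) \<Rightarrow> complex" where
  "polarization m p x = (\<Sum>S\<in>Pow {..<m}. (-1) ^ (m - card S) * p (\<Sum>i\<in>S. x i))"

definition surjections :: "nat \<Rightarrow> (nat \<Rightarrow> nat) set" where
  "surjections m = {f \<in> {..<m} \<rightarrow>\<^sub>E {..<m}. f ` {..<m} = {..<m}}"

lemma finite_surjections: "finite (surjections m)"
  by (simp add: surjections_def finite_PiE)

lemma card_surjections_pos: "card (surjections m) > 0"
proof -
  have "(\<lambda>i\<in>{..<m}. i) \<in> surjections m"
    by (auto simp: surjections_def)
  then show ?thesis using finite_surjections card_gt_0_iff by blast
qed

text \<open>
  The polarization identity. Expanding \<open>L\<close> multilinearly turns the left-hand side into a sum over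
  all maps \<open>f\<close> of \<open>{..<m}\<close> into itself, and \<open>f\<close> occurs with the coefficient
  \<open>\<Sum>S \<supseteq> f ` {..<m}. (-1) ^ (m - card S)\<close>. This is the expansion of the product over \<open>i < m\<close> of
  \<open>1 - [i \<notin> f ` {..<m}]\<close>, so that it is \<open>1\<close> if \<open>f\<close> is onto and \<open>0\<close> otherwise.
\<close>

lemma polarization_eq_sum_surjections:
  assumes L: "continuous_multilinear m L" and p: "\<And>x. p x = L (\<lambda>i\<in>{..<m}. x)"
  shows "polarization m p x = (\<Sum>f\<in>surjections m. L (\<lambda>i\<in>{..<m}. x (f i)))"
proof -
  let ?I = "{..<m}"
  let ?L = "\<lambda>f. L (\<lambda>i\<in>?I. x (f i))"
  have expand: "p (\<Sum>i\<in>S. x i) = (\<Sum>f\<in>?I \<rightarrow>\<^sub>E ?I. of_bool (f ` ?I \<subseteq> S) * ?L f)"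
    if "S \<subseteq> ?I" for S
  proof -
    have "p (\<Sum>i\<in>S. x i) = (\<Sum>f\<in>?I \<rightarrow>\<^sub>E S. ?L f)"
      using continuous_multilinear_expand[OF L, of S m x] finite_subset[OF that]
      by (simp add: p cong: restrict_cong)
    also have "\<dots> = (\<Sum>f\<in>?I \<rightarrow>\<^sub>E ?I. of_bool (f ` ?I \<subseteq> S) * ?L f)"
      by (rule sum.mono_neutral_cong_left) (use that in \<open>auto simp: finite_PiE PiE_iff\<close>)
    finally show ?thesis .
  qed
  have coeff: "(\<Sum>S\<in>Pow ?I. (-1) ^ (m - card S) * of_bool (R \<subseteq> S)) = (of_bool (R = ?I) :: complex)"
    if "R \<subseteq> ?I" for R
  proof -
    have "(\<Sum>S\<in>Pow ?I. (-1) ^ (m - card S) * of_bool (R \<subseteq> S)) =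
        (\<Sum>S\<in>Pow ?I. (-1) ^ (card ?I - card S) * (\<Prod>i\<in>S. 1) * (\<Prod>i\<in>?I - S. of_bool (i \<notin> R)) :: complex)"
    proof (rule sum.cong)
      fix S assume "S \<in> Pow ?I"
      then have "(\<Prod>i\<in>?I - S. of_bool (i \<notin> R)) = (of_bool (R \<subseteq> S) :: complex)"
        using that by (cases "R \<subseteq> S") (auto simp: prod_zero_iff intro!: prod.neutral)
      then show "(-1) ^ (m - card S) * of_bool (R \<subseteq> S) = ((-1) ^ (card ?I - card S) *
          (\<Prod>i\<in>S. 1) * (\<Prod>i\<in>?I - S. of_bool (i \<notin> R)) :: complex)"
        by simp
    qed simp
    also have "\<dots> = (\<Prod>i\<in>?I. 1 - of_bool (i \<notin> R))"
      by (rule prod_diff_conv_sum'[symmetric]) simp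
    also have "\<dots> = of_bool (R = ?I)"
      using that by (auto simp: prod_zero_iff)
    finally show ?thesis .
  qed
  have "polarization m p x = (\<Sum>S\<in>Pow ?I. \<Sum>f\<in>?I \<rightarrow>\<^sub>E ?I.
      (-1) ^ (m - card S) * (of_bool (f ` ?I \<subseteq> S) * ?L f))"
    unfolding polarization_def sum_distrib_left[symmetric]
    by (intro sum.cong refl) (simp only: Pow_iff expand)
  also have "\<dots> = (\<Sum>f\<in>?I \<rightarrow>\<^sub>E ?I. (\<Sum>S\<in>Pow ?I. (-1) ^ (m - card S) * of_bool (f ` ?I \<subseteq> S)) * ?L f)"
    by (subst sum.swap) (simp only: sum_distrib_right mult.assoc)
  also have "\<dots> = (\<Sum>f\<in>?I \<rightarrow>\<^sub>E ?I. of_bool (f ` ?I = ?I) * ?L f)"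
    by (intro sum.cong refl arg_cong2[where f = "(*)"] coeff) auto
  also have "\<dots> = (\<Sum>f\<in>surjections m. ?L f)"
    unfolding surjections_def
    by (rule sum.mono_neutral_cong_right) (auto simp: finite_PiE)
  finally show ?thesis .
qed

text \<open>
  A surjection of a finite set onto itself is injective, so that the variable \<open>x j\<close> enters
  \<open>L (x \<circ> f)\<close> in exactly one argument. Hence each summand in the polarization identity is linear in
  \<open>x j\<close>, and so is the polarization.
\<close>

lemma surjections_upd:
  assumes "f \<in> surjections m" "j < m"
  obtains i where "i < m"
    "\<And>x v. (\<lambda>k\<in>{..<m}. (x(j := v)) (f k)) = (\<lambda>k\<in>{..<m}. x (f k))(i := v)"
proof -
  have f: "f ` {..<m} = {..<m}" using assms by (simp add: surjections_def)
  then have inj: "inj_on f {..<m}" by (simp add: eq_card_imp_inj_on)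
  obtain i where i: "i < m" "f i = j" using f assms(2) by (metis imageE lessThan_iff)
  have "f k = j \<longleftrightarrow> k = i" if "k < m" for k
    using inj i that by (auto simp: inj_on_def)
  then show ?thesis using i(1) by (intro that[of i]) (auto simp: fun_eq_iff restrict_def)
qed

lemma polarization_add:
  fixes p :: "'a::complex_banach \<Rightarrow> complex"
  assumes "p \<in> hom_polys m" "j < m"
  shows "polarization m p (x(j := u + v)) = polarization m p (x(j := u)) + polarization m p (x(j := v))"
proof -
  obtain L where L: "continuous_multilinear m L" "\<And>x. p x = L (\<lambda>i\<in>{..<m}. x)"
    using assms(1) by (auto simp: hom_polys_def)
  have "L (\<lambda>k\<in>{..<m}. (x(j := u + v)) (f k)) =
      L (\<lambda>k\<in>{..<m}. (x(j := u)) (f k)) + L (\<lambda>k\<in>{..<m}. (x(j := v)) (f k))"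
    if f: "f \<in> surjections m" for f
  proof -
    obtain i where i: "i < m"
      "\<And>(x :: nat \<Rightarrow> 'a) v. (\<lambda>k\<in>{..<m}. (x(j := v)) (f k)) = (\<lambda>k\<in>{..<m}. x (f k))(i := v)"
      using surjections_upd[OF f assms(2)] by blast
    show ?thesis unfolding i(2) by (rule continuous_multilinear_add[OF L(1) _ i(1)]) simp
  qed
  then show ?thesis
    unfolding polarization_eq_sum_surjections[OF L] sum.distrib[symmetric] by (rule sum.cong[OF refl])
qed

lemma polarization_scale:
  fixes p :: "'a::complex_banach \<Rightarrow> complex"
  assumes "p \<in> hom_polys m" "j < m"
  shows "polarization m p (x(j := c *\<^sub>C u)) = c * polarization m p (x(j := u))"
proof -
  obtain L where L: "continuous_multilinear m L" "\<And>x. p x = L (\<lambda>i\<in>{..<m}. x)"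
    using assms(1) by (auto simp: hom_polys_def)
  have "L (\<lambda>k\<in>{..<m}. (x(j := c *\<^sub>C u)) (f k)) = c * L (\<lambda>k\<in>{..<m}. (x(j := u)) (f k))"
    if f: "f \<in> surjections m" for f
  proof -
    obtain i where i: "i < m"
      "\<And>(x :: nat \<Rightarrow> 'a) v. (\<lambda>k\<in>{..<m}. (x(j := v)) (f k)) = (\<lambda>k\<in>{..<m}. x (f k))(i := v)"
      using surjections_upd[OF f assms(2)] by blast
    show ?thesis unfolding i(2) by (rule continuous_multilinear_scale[OF L(1) _ i(1)]) simp
  qed
  then show ?thesis
    unfolding polarization_eq_sum_surjections[OF L] sum_distrib_left by (rule sum.cong[OF refl])
qed

lemma polarization_diagonal:
  assumes "p \<in> hom_polys m"
  shows "polarization m p (\<lambda>i\<in>{..<m}. x) = of_nat (card (surjections m)) * p x"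
proof -
  obtain L where L: "continuous_multilinear m L" "\<And>x. p x = L (\<lambda>i\<in>{..<m}. x)"
    using assms(1) by (auto simp: hom_polys_def)
  have "(\<lambda>k\<in>{..<m}. (\<lambda>i\<in>{..<m}. x) (f k)) = (\<lambda>i\<in>{..<m}. x)" if "f \<in> surjections m" for f
    using that by (auto simp: fun_eq_iff restrict_def surjections_def)
  then have "(\<Sum>f\<in>surjections m. L (\<lambda>k\<in>{..<m}. (\<lambda>i\<in>{..<m}. x) (f k))) =
      (\<Sum>f\<in>surjections m. p x)"
    by (intro sum.cong) (simp_all only: L(2))
  then show ?thesis by (simp only: polarization_eq_sum_surjections[OF L]) simp
qed

section \<open>Homogeneous polynomials\<close>

lemma hom_poly_scale:
  assumes "p \<in> hom_polys m"
  shows "p (c *\<^sub>C x) = c ^ m * p x"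
proof -
  obtain L where L: "continuous_multilinear m L" "\<And>x. p x = L (\<lambda>i\<in>{..<m}. x)"
    using assms by (auto simp: hom_polys_def)
  show ?thesis
    using continuous_multilinear_scale_all[OF L(1), of m c "\<lambda>_. x"]
    by (simp add: L(2) cong: restrict_cong)
qed

lemma hom_poly_holomorphic_on_lines:
  assumes "p \<in> hom_polys m"
  shows "(\<lambda>t. p (x + t *\<^sub>C h)) holomorphic_on UNIV"
proof -
  obtain L where L: "continuous_multilinear m L" "\<And>x. p x = L (\<lambda>i\<in>{..<m}. x)"
    using assms by (auto simp: hom_polys_def)
  show ?thesis
    using continuous_multilinear_holomorphic_on_lines[OF L(1), of m "\<lambda>_. x" "\<lambda>_. h"]
    by (simp add: L(2) cong: restrict_cong)
qed

lemma hom_poly_continuous_on: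
  assumes "p \<in> hom_polys m"
  shows "continuous_on S p"
proof -
  obtain L where L: "continuous_multilinear m L" "\<And>x. p x = L (\<lambda>i\<in>{..<m}. x)"
    using assms by (auto simp: hom_polys_def)
  have "continuous_map euclidean (product_topology (\<lambda>_. euclidean) {..<m}) (\<lambda>x. \<lambda>i\<in>{..<m}. x :: 'a)"
    by (auto simp: continuous_map_componentwise)
  then have "continuous_map euclidean euclidean (L \<circ> (\<lambda>x. \<lambda>i\<in>{..<m}. x))"
    using L(1) continuous_map_compose unfolding continuous_multilinear_def by blast
  moreover have "L \<circ> (\<lambda>x. \<lambda>i\<in>{..<m}. x) = p"
    by (simp add: L(2) fun_eq_iff)
  ultimately show ?thesis
    by (auto intro: continuous_on_subset)
qed

text \<open>
  A form that represents \<open>p n\<close> is not unique, and arbitrary choices need not converge with \<open>n\<close>.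
  The polarization is a choice that depends only on the values of the polynomial, so that it
  inherits multilinearity from the \<open>p n\<close> and continuity from \<open>q\<close>.
\<close>

lemma hom_polys_pointwise_limit:
  assumes p: "\<And>n::nat. p n \<in> hom_polys m" and lim: "\<And>x. (\<lambda>n. p n x) \<longlonglongrightarrow> q x"
    and cont: "continuous_on UNIV q"
  shows "q \<in> hom_polys m"
proof -
  have lim_pol: "(\<lambda>n. polarization m (p n) x) \<longlonglongrightarrow> polarization m q x" for x
    unfolding polarization_def by (intro tendsto_intros lim)
  have add: "polarization m q (x(j := u + v)) =
      polarization m q (x(j := u)) + polarization m q (x(j := v))" if "j < m" for x j u v
  proof (rule LIMSEQ_unique[OF lim_pol])
    show "(\<lambda>n. polarization m (p n) (x(j := u + v))) \<longlonglongrightarrow>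
        polarization m q (x(j := u)) + polarization m q (x(j := v))"
      unfolding polarization_add[OF p that] by (intro tendsto_intros lim_pol)
  qed
  have scale: "polarization m q (x(j := c *\<^sub>C u)) = c * polarization m q (x(j := u))"
    if "j < m" for x j c u
  proof (rule LIMSEQ_unique[OF lim_pol])
    show "(\<lambda>n. polarization m (p n) (x(j := c *\<^sub>C u))) \<longlonglongrightarrow> c * polarization m q (x(j := u))"
      unfolding polarization_scale[OF p that] by (intro tendsto_intros lim_pol)
  qed
  have diag: "polarization m q (\<lambda>i\<in>{..<m}. x) = of_nat (card (surjections m)) * q x" for x
  proof (rule LIMSEQ_unique[OF lim_pol])
    show "(\<lambda>n. polarization m (p n) (\<lambda>i\<in>{..<m}. x)) \<longlonglongrightarrow> of_nat (card (surjections m)) * q x"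
      unfolding polarization_diagonal[OF p] by (intro tendsto_intros lim)
  qed
  let ?X = "product_topology (\<lambda>_. euclidean) {..<m} :: (nat \<Rightarrow> 'a) topology"
  let ?N = "of_nat (card (surjections m)) :: complex"
  have N: "?N \<noteq> 0" using card_surjections_pos[of m] by simp
  let ?L = "\<lambda>x. inverse ?N * polarization m q x"
  have scalars: "continuous_map ?X euclidean (\<lambda>x. c * g x)"
    if "continuous_map ?X euclidean g" for c :: complex and g
    using continuous_map_compose[OF that, of euclidean "\<lambda>z. c * z"]
    by (simp add: o_def continuous_on_mult_left)
  have "continuous_map ?X euclidean (\<lambda>x. q (\<Sum>i\<in>S. x i))" if "S \<subseteq> {..<m}" for S
  proof -
    have "continuous_map ?X euclidean (\<lambda>x. \<Sum>i\<in>S. x i)"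
      using that finite_subset[OF that]
      by (intro continuous_map_sum) (auto intro!: continuous_map_product_projection)
    from continuous_map_compose[OF this, of euclidean q] show ?thesis
      using cont by (simp add: o_def)
  qed
  then have "continuous_map ?X euclidean ?L"
    unfolding polarization_def by (intro scalars continuous_map_sum) auto
  then have "continuous_multilinear m ?L"
    unfolding continuous_multilinear_def by (simp add: add scale algebra_simps)
  moreover have "q x = ?L (\<lambda>i\<in>{..<m}. x)" for x
    using N by (simp add: diag)
  ultimately show ?thesis unfolding hom_polys_def by blast
qed

section \<open>Bounded and equicontinuous families in the compact-open topology\<close>

text \<open>
  Metric spaces are compactly generated: a convergent sequence together with its limit is compact,
  and continuity can be tested on such sets.
\<close>

lemma continuous_on_of_uniform_limits_on_compacts:
  fixes q :: "'a::metric_space \<Rightarrow> 'b::metric_space"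
  assumes cont: "\<And>n. continuous_on UNIV (p n)"
    and lim: "\<And>K. compact K \<Longrightarrow> uniform_limit K p q sequentially"
  shows "continuous_on UNIV q"
  unfolding continuous_on_sequentially
proof (intro allI ballI impI)
  fix s :: "nat \<Rightarrow> 'a" and a
  assume "(\<forall>n. s n \<in> UNIV) \<and> s \<longlonglongrightarrow> a"
  then have s: "s \<longlonglongrightarrow> a" by simp
  let ?K = "insert a (range s)"
  have "compact ?K"
    using compactin_sequence_with_limit[of euclidean s a "range s"] s by simp
  then have "continuous_on ?K q"
    using uniform_limit_theorem[OF _ lim] cont continuous_on_subset
    by (metis (no_types, lifting) UNIV_I always_eventually subsetI trivial_limit_sequentially)
  then show "(q \<circ> s) \<longlonglongrightarrow> q a"
    unfolding continuous_on_sequentially using s by auto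
qed

lemma zero_nhds_hom_poly_space:
  assumes "V \<in> zero_nhds (hom_poly_space m)"
  obtains K e where "compact K" "e > 0"
    "\<And>p. p \<in> hom_polys m \<Longrightarrow> (\<And>x. x \<in> K \<Longrightarrow> norm (p x) < e) \<Longrightarrow> p \<in> V"
proof -
  have "openin (compact_open_topology (hom_polys m)) V" "0 \<in> V"
    using assms by (auto simp: zero_nhds_def hom_poly_space_def)
  then obtain K e where "compact K" "e > 0" "{q \<in> hom_polys m. \<forall>x\<in>K. dist (q x) (0 x) < e} \<subseteq> V"
    unfolding openin_compact_open_topology by blast
  then show ?thesis by (intro that[of K e]) (auto simp: subset_iff)
qed

lemma less_on_compact_imp_gap:
  fixes f :: "'a::topological_space \<Rightarrow> real"
  assumes "compact K" "continuous_on K f" "\<And>x. x \<in> K \<Longrightarrow> f x < e"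
  obtains d where "d > 0" "\<And>x. x \<in> K \<Longrightarrow> f x + d \<le> e"
proof (cases "K = {}")
  case True
  then show ?thesis using that[of 1] by simp
next
  case False
  then obtain z where "z \<in> K" "\<And>x. x \<in> K \<Longrightarrow> f x \<le> f z"
    using continuous_attains_sup[OF assms(1) _ assms(2)] by blast
  then show ?thesis using that[of "e - f z"] assms(3) by force
qed

text \<open>
  Openness uses compactness of \<open>K\<close>: \<open>norm \<circ> p\<close> attains its supremum on \<open>K\<close>, so that
  the pointwise bound by \<open>e\<close> leaves room for a uniform perturbation.
\<close>

lemma zero_nhds_hom_poly_spaceI:
  assumes "compact K" "e > 0"
  shows "{p \<in> hom_polys m. \<forall>x\<in>K. norm (p x) < e} \<in> zero_nhds (hom_poly_space m)"
proof -
  let ?V = "{p \<in> hom_polys m. \<forall>x\<in>K. norm (p x) < e}"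
  have "openin (compact_open_topology (hom_polys m)) ?V"
    unfolding openin_compact_open_topology
  proof (intro conjI ballI)
    fix p assume p: "p \<in> ?V"
    have "continuous_on K (\<lambda>x. norm (p x))"
      using p by (auto intro: continuous_on_norm hom_poly_continuous_on)
    then obtain d where d: "d > 0" "\<And>x. x \<in> K \<Longrightarrow> norm (p x) + d \<le> e"
      using less_on_compact_imp_gap[OF assms(1), of "\<lambda>x. norm (p x)" e] p by blast
    have "norm (q x) < e" if "x \<in> K" "dist (q x) (p x) < d" for q x
      using d(2)[OF that(1)] that(2) norm_triangle_ineq2[of "q x" "p x"] by (simp add: dist_norm)
    then have "{q \<in> hom_polys m. \<forall>x\<in>K. dist (q x) (p x) < d} \<subseteq> ?V" by blast
    then show "\<exists>K e. compact K \<and> e > 0 \<and> {q \<in> hom_polys m. \<forall>x\<in>K. dist (q x) (p x) < e} \<subseteq> ?V"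
      using assms(1) d(1) by blast
  qed simp
  moreover have "0 \<in> ?V"
    using assms(2) complex_vector.subspace_0[OF subspace_hom_polys] by simp
  ultimately show ?thesis by (simp add: zero_nhds_def hom_poly_space_def)
qed

lemma tvs_bounded_hom_poly_space_iff:
  "tvs_bounded (hom_poly_space m) B \<longleftrightarrow>
    B \<subseteq> hom_polys m \<and> (\<forall>K. compact K \<longrightarrow> (\<exists>M. \<forall>p\<in>B. \<forall>x\<in>K. norm (p x) \<le> M))"
proof (intro iffI conjI allI impI)
  assume B: "tvs_bounded (hom_poly_space m) B"
  then show "B \<subseteq> hom_polys m" by (simp add: tvs_bounded_def)
  fix K :: "'a set" assume "compact K"
  then have "{p \<in> hom_polys m. \<forall>x\<in>K. norm (p x) < 1} \<in> zero_nhds (hom_poly_space m)"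
    by (intro zero_nhds_hom_poly_spaceI) auto
  then obtain r where r: "r > 0" "\<And>c. norm c \<ge> r \<Longrightarrow>
      B \<subseteq> (\<lambda>p. c *\<^sub>C p) ` {p \<in> hom_polys m. \<forall>x\<in>K. norm (p x) < 1}"
    using B unfolding tvs_bounded_def by blast
  have "norm (p x) \<le> r" if p: "p \<in> B" and x: "x \<in> K" for p x
  proof -
    have "p \<in> (\<lambda>p. of_real r *\<^sub>C p) ` {p \<in> hom_polys m. \<forall>x\<in>K. norm (p x) < 1}"
      using r(2)[of "of_real r"] r(1) p by auto
    then obtain q where "p = of_real r *\<^sub>C q" "norm (q x) < 1" using x by blast
    then show ?thesis using r(1) by (simp add: scaleC_fun_def scaleC_complex_def norm_mult)
  qed
  then show "\<exists>M. \<forall>p\<in>B. \<forall>x\<in>K. norm (p x) \<le> M" by blast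
next
  assume B: "B \<subseteq> hom_polys m \<and> (\<forall>K. compact K \<longrightarrow> (\<exists>M. \<forall>p\<in>B. \<forall>x\<in>K. norm (p x) \<le> M))"
  have "\<exists>r>0. \<forall>c. norm c \<ge> r \<longrightarrow> B \<subseteq> (\<lambda>p. c *\<^sub>C p) ` V"
    if V: "V \<in> zero_nhds (hom_poly_space m)" for V
  proof -
    obtain K e where K: "compact K" "e > 0"
      "\<And>p. p \<in> hom_polys m \<Longrightarrow> (\<And>x. x \<in> K \<Longrightarrow> norm (p x) < e) \<Longrightarrow> p \<in> V"
      using zero_nhds_hom_poly_space[OF V] by blast
    obtain M where M: "\<And>p x. p \<in> B \<Longrightarrow> x \<in> K \<Longrightarrow> norm (p x) \<le> M"
      using B K(1) by meson
    define r where "r = (\<bar>M\<bar> + 1) / e"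
    have r: "r > 0" using K(2) by (simp add: r_def)
    have "p \<in> (\<lambda>p. c *\<^sub>C p) ` V" if c: "norm c \<ge> r" and p: "p \<in> B" for c p
    proof
      have c0: "c \<noteq> 0" using c r by auto
      show "p = c *\<^sub>C (inverse c *\<^sub>C p)"
        using c0 by (simp add: scaleC_scaleC scaleC_one)
      show "inverse c *\<^sub>C p \<in> V"
      proof (rule K(3))
        show "inverse c *\<^sub>C p \<in> hom_polys m"
          using B p by (intro complex_vector.subspace_scale[OF subspace_hom_polys]) auto
        fix x assume "x \<in> K"
        then have "norm (p x) < \<bar>M\<bar> + 1" using M[OF p] by force
        also have "\<dots> \<le> norm c * e" using c K(2) by (simp add: r_def field_simps)
        finally have "norm (p x) / norm c < e"
          using c0 by (simp add: pos_divide_less_eq mult.commute)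
        then show "norm ((inverse c *\<^sub>C p) x) < e"
          by (simp add: scaleC_fun_def scaleC_complex_def norm_mult norm_inverse divide_inverse
              mult.commute)
      qed
    qed
    then show ?thesis using r by blast
  qed
  then show "tvs_bounded (hom_poly_space m) B" using B by (simp add: tvs_bounded_def)
qed

text \<open>
  If the bound failed on a ball, there would be \<open>p n \<in> B\<close> and points \<open>x n\<close> of the ball such that
  \<open>p n\<close> exceeds \<open>Suc n ^ Suc m\<close> at \<open>x n\<close>. By homogeneity \<open>p n\<close> still exceeds \<open>Suc n\<close> at
  \<open>x n / Suc n\<close>, and these points form, with their limit \<open>0\<close>, a compact set.
\<close>

lemma tvs_bounded_imp_bounded_on_balls:
  assumes B: "tvs_bounded (hom_poly_space m) B"
  obtains M where "\<And>p x. p \<in> B \<Longrightarrow> norm x \<le> R \<Longrightarrow> norm (p x) \<le> M"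
proof (rule ccontr)
  assume neg: "\<not> thesis"
  have "\<exists>p x. p \<in> B \<and> norm x \<le> R \<and> norm (p x) > real (Suc n) ^ Suc m" for n
    using neg that[of "real (Suc n) ^ Suc m"] by (meson not_le)
  then obtain p x where px: "\<And>n. p n \<in> B" "\<And>n. norm (x n) \<le> R"
    "\<And>n. norm (p n (x n)) > real (Suc n) ^ Suc m" by metis
  define y where "y n = inverse (of_nat (Suc n)) *\<^sub>C x n" for n
  have "(\<lambda>n. R * inverse (real (Suc n))) \<longlonglongrightarrow> R * 0"
    by (intro tendsto_mult tendsto_const LIMSEQ_inverse_real_of_nat)
  moreover have "norm (y n) \<le> R * inverse (real (Suc n))" for n
    using mult_right_mono[OF px(2)[of n], of "inverse (real (Suc n))"]
    by (simp add: y_def norm_scaleC norm_inverse mult.commute del: of_nat_Suc)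
  ultimately have "y \<longlonglongrightarrow> 0"
    by (intro Lim_null_comparison[of y]) auto
  then have "compact (insert 0 (range y))"
    using compactin_sequence_with_limit[of euclidean y 0 "range y"] by simp
  then obtain M where M: "\<And>p x. p \<in> B \<Longrightarrow> x \<in> insert 0 (range y) \<Longrightarrow> norm (p x) \<le> M"
    using B unfolding tvs_bounded_hom_poly_space_iff by meson
  have "real (Suc n) < M" for n
  proof -
    have "p n (y n) = inverse (of_nat (Suc n)) ^ m * p n (x n)"
      using B px(1) unfolding y_def tvs_bounded_hom_poly_space_iff by (intro hom_poly_scale) auto
    then have "norm (p n (x n)) = real (Suc n) ^ m * norm (p n (y n))"
      by (simp add: norm_mult norm_power norm_inverse power_inverse del: of_nat_Suc)
    also have "\<dots> \<le> real (Suc n) ^ m * M"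
      using M[OF px(1)] by (intro mult_left_mono) auto
    finally have "real (Suc n) ^ m * real (Suc n) < real (Suc n) ^ m * M"
      by (rule order.strict_trans2[OF px(3)[of n, unfolded power_Suc2]])
    then show ?thesis by (rule mult_left_less_imp_less) simp
  qed
  moreover obtain n where "M < real n" using reals_Archimedean2 by blast
  ultimately show False by (metis less_asym less_trans lessI of_nat_less_iff)
qed

text \<open>
  On a complex line through \<open>x\<close> a polynomial is an entire function, so that by the Schwarz lemma
  its oscillation near \<open>x\<close> is controlled by its size on the unit disc around \<open>x\<close>.
\<close>

lemma hom_poly_lipschitz:
  assumes p: "p \<in> hom_polys m" and M: "\<And>z. norm z \<le> R + 1 \<Longrightarrow> norm (p z) \<le> M"
    and x: "norm x \<le> R" and xy: "norm (y - x) < 1"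
  shows "norm (p y - p x) \<le> (2 * M + 1) * norm (y - x)"
proof (cases "y = x")
  case False
  let ?r = "norm (y - x)"
  have r: "?r > 0" using False by simp
  define h where "h = inverse (of_real ?r) *\<^sub>C (y - x)"
  have h: "norm h = 1" using r by (simp add: h_def norm_scaleC norm_inverse)
  have y: "y = x + of_real ?r *\<^sub>C h"
    using r by (simp add: h_def scaleC_scaleC scaleC_one)
  have M0: "M \<ge> 0" using M[of x] x norm_ge_zero[of "p x"] by linarith
  \<comment> \<open>The summand \<open>1\<close> provides the strict bound by \<open>1\<close> required by the Schwarz lemma.\<close>
  define f where "f t = (p (x + t *\<^sub>C h) - p x) / of_real (2 * M + 1)" for t
  have "norm (f (of_real ?r)) \<le> norm (of_real ?r :: complex)"
  proof (rule Schwarz_Lemma(1))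
    show "f holomorphic_on ball 0 1"
      unfolding f_def using M0 holomorphic_on_subset[OF hom_poly_holomorphic_on_lines[OF p]]
      by (intro holomorphic_intros) (auto simp flip: of_real_mult of_real_add)
    show "f 0 = 0" by (simp add: f_def)
    show "norm (f t) < 1" if "norm t < 1" for t
    proof -
      have "norm (x + t *\<^sub>C h) \<le> R + 1"
        using norm_triangle_ineq[of x "t *\<^sub>C h"] x that by (simp add: norm_scaleC h)
      then have "norm (p (x + t *\<^sub>C h) - p x) \<le> M + M"
        using M[of "x + t *\<^sub>C h"] M[of x] x norm_triangle_ineq4[of "p (x + t *\<^sub>C h)" "p x"] by linarith
      then have "norm (p (x + t *\<^sub>C h) - p x) < 2 * M + 1" by linarith
      then show ?thesis using M0 by (simp add: f_def norm_divide del: of_real_add of_real_mult)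
    qed
    show "norm (of_real ?r :: complex) < 1" using xy by simp
  qed
  then have "norm (p (x + of_real ?r *\<^sub>C h) - p x) \<le> (2 * M + 1) * ?r"
    using M0 by (simp add: f_def norm_divide pos_divide_le_eq mult.commute
      del: of_real_add of_real_mult)
  then show ?thesis by (simp only: y[symmetric])
qed simp

lemma finite_net_pointwise:
  fixes B :: "('a \<Rightarrow> 'b::heine_borel) set"
  assumes "finite G" "\<And>g. g \<in> G \<Longrightarrow> bounded ((\<lambda>p. p g) ` B)" "e > 0"
  obtains F where "finite F" "F \<subseteq> B" "\<And>p. p \<in> B \<Longrightarrow> \<exists>q\<in>F. \<forall>g\<in>G. dist (p g) (q g) < e"
proof -
  have "\<exists>Z. finite Z \<and> (\<lambda>p. p g) ` B \<subseteq> (\<Union>z\<in>Z. ball z (e / 2))" if "g \<in> G" for g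
  proof -
    have "compact (closure ((\<lambda>p. p g) ` B))"
      using assms(2)[OF that] by (simp add: compact_closure)
    then obtain Z where "finite Z" "closure ((\<lambda>p. p g) ` B) \<subseteq> (\<Union>z\<in>Z. ball z (e / 2))"
      unfolding compact_eq_totally_bounded using half_gt_zero[OF assms(3)] by blast
    then show ?thesis using closure_subset[of "(\<lambda>p. p g) ` B"] by (intro exI[of _ Z]) auto
  qed
  then obtain Z where Z: "\<And>g. g \<in> G \<Longrightarrow> finite (Z g)"
    "\<And>g. g \<in> G \<Longrightarrow> (\<lambda>p. p g) ` B \<subseteq> (\<Union>z\<in>Z g. ball z (e / 2))" by metis
  have "\<exists>z. z \<in> Z g \<and> dist z (p g) < e / 2" if "p \<in> B" "g \<in> G" for p g
    using Z(2)[OF that(2)] that(1) unfolding image_subset_iff UN_iff mem_ball by blast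
  then obtain c where c: "\<And>p g. p \<in> B \<Longrightarrow> g \<in> G \<Longrightarrow> c p g \<in> Z g \<and> dist (c p g) (p g) < e / 2"
    by metis
  \<comment> \<open>Rounding the values on \<open>G\<close> leaves finitely many codes; \<open>F\<close> has an element for each of them.\<close>
  define code where "code p = (\<lambda>g\<in>G. c p g)" for p
  have "code ` B \<subseteq> Pi\<^sub>E G Z" using c by (auto simp: code_def)
  then have "finite (code ` B)"
    by (rule finite_subset) (intro finite_PiE assms(1) Z(1))
  then obtain F where F: "F \<subseteq> B" "finite F" "code ` B = code ` F"
    using finite_subset_image[of "code ` B" code B] by auto
  have "\<exists>q\<in>F. \<forall>g\<in>G. dist (p g) (q g) < e" if p: "p \<in> B" for p
  proof -
    obtain q where q: "q \<in> F" "code p = code q" using F(3) p by blast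
    have "dist (p g) (q g) < e" if g: "g \<in> G" for g
    proof -
      have "c p g = c q g" using fun_cong[OF q(2), of g] g by (simp add: code_def)
      then show ?thesis using c[OF p g] c[of q g] q(1) F(1) g
        by (metis dist_commute dist_triangle_half_r subsetD)
    qed
    then show ?thesis using q(1) by blast
  qed
  then show ?thesis using that F by blast
qed

text \<open>
  This is Ascoli's theorem in terms of nets: bounded sets of polynomials are bounded on balls, hence
  equicontinuous, and so their uniform distance on \<open>K\<close> is determined up to \<open>e\<close> by the values on a
  finite subset of \<open>K\<close>.
\<close>

lemma tvs_bounded_imp_finite_net:
  assumes B: "tvs_bounded (hom_poly_space m) B" and K: "compact K" and e: "e > 0"
  obtains F where "finite F" "F \<subseteq> B" "\<And>p. p \<in> B \<Longrightarrow> \<exists>q\<in>F. \<forall>x\<in>K. norm (p x - q x) < e"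
proof -
  have sub: "B \<subseteq> hom_polys m" using B by (simp add: tvs_bounded_hom_poly_space_iff)
  obtain R where R: "\<And>x. x \<in> K \<Longrightarrow> norm x \<le> R"
    using compact_imp_bounded[OF K] by (auto simp: bounded_iff)
  obtain M where M: "\<And>p x. p \<in> B \<Longrightarrow> norm x \<le> R + 1 \<Longrightarrow> norm (p x) \<le> M"
    using tvs_bounded_imp_bounded_on_balls[OF B] by blast
  define d where "d = min 1 (e / (3 * (2 * \<bar>M\<bar> + 1)))"
  have d: "d > 0" "d \<le> 1" "(2 * \<bar>M\<bar> + 1) * d \<le> e / 3"
  proof -
    show "d > 0" "d \<le> 1" using e by (auto simp: d_def)
    have "d \<le> e / (3 * (2 * \<bar>M\<bar> + 1))" by (simp add: d_def)
    then have "d * (3 * (2 * \<bar>M\<bar> + 1)) \<le> e" by (subst (asm) pos_le_divide_eq) auto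
    then show "(2 * \<bar>M\<bar> + 1) * d \<le> e / 3" by (simp add: algebra_simps)
  qed
  obtain G where G: "finite G" "G \<subseteq> K" "K \<subseteq> (\<Union>g\<in>G. ball g d)"
  proof (rule compactE_image[OF K, of K "\<lambda>g. ball g d"])
    show "K \<subseteq> (\<Union>g\<in>K. ball g d)" using d(1) by force
  qed auto
  have "bounded ((\<lambda>p. p g) ` B)" if "g \<in> G" for g
  proof -
    have "norm g \<le> R + 1" using R[of g] that G(2) by auto
    then show ?thesis unfolding bounded_iff using M by blast
  qed
  then obtain F where F: "finite F" "F \<subseteq> B" "\<And>p. p \<in> B \<Longrightarrow> \<exists>q\<in>F. \<forall>g\<in>G. dist (p g) (q g) < e / 3"
    using finite_net_pointwise[OF G(1), of B "e / 3"] e by (metis divide_pos_pos zero_less_numeral)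
  have lip: "norm (p x - p g) \<le> e / 3" if "p \<in> B" "g \<in> G" "x \<in> ball g d" for p g x
  proof -
    have dist: "norm (x - g) < d" using that(3) by (simp add: dist_norm norm_minus_commute)
    have "norm (p x - p g) \<le> (2 * \<bar>M\<bar> + 1) * norm (x - g)"
    proof (rule hom_poly_lipschitz)
      show "norm (p z) \<le> \<bar>M\<bar>" if "norm z \<le> R + 1" for z
        using M[OF \<open>p \<in> B\<close> that] by linarith
      show "p \<in> hom_polys m" "norm g \<le> R" "norm (x - g) < 1"
        using sub \<open>p \<in> B\<close> \<open>g \<in> G\<close> G(2) R dist d(2) by auto
    qed
    also have "\<dots> \<le> (2 * \<bar>M\<bar> + 1) * d" using dist by (intro mult_left_mono) auto
    finally show ?thesis using d(3) by linarith
  qed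
  have "\<exists>q\<in>F. \<forall>x\<in>K. norm (p x - q x) < e" if p: "p \<in> B" for p
  proof -
    obtain q where q: "q \<in> F" "\<And>g. g \<in> G \<Longrightarrow> norm (p g - q g) < e / 3"
      using F(3)[OF p] by (auto simp: dist_norm)
    have "norm (p x - q x) < e" if x: "x \<in> K" for x
    proof -
      obtain g where g: "g \<in> G" "x \<in> ball g d" using G(3) x by blast
      have "p x - q x = (p x - p g) + (p g - q g) - (q x - q g)" by simp
      also have "norm \<dots> \<le> norm (p x - p g) + norm (p g - q g) + norm (q x - q g)"
        by (meson add_mono norm_triangle_ineq norm_triangle_ineq4 order_trans order_refl)
      also have "\<dots> < e" using lip[OF p g] lip[OF _ g, of q] q F(2) g by fastforce
      finally show ?thesis .
    qed
    then show ?thesis using q(1) by blast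
  qed
  then show ?thesis using that F by blast
qed

section \<open>Means of almost periodic sequences\<close>

lemma norm_sum_shift_diff_le:
  fixes b :: "nat \<Rightarrow> 'b::real_normed_vector"
  assumes "\<And>k. norm (b k) \<le> C"
  shows "norm ((\<Sum>k<n. b (k + j)) - (\<Sum>k<n. b k)) \<le> 2 * real j * C"
proof (induction j)
  case (Suc j)
  have step: "(\<Sum>k<n. b (k + Suc j)) - (\<Sum>k<n. b (k + j)) = b (n + j) - b j"
    using sum_lessThan_telescope[of "\<lambda>k. b (k + j)" n] by (simp add: sum_subtractf)
  have "(\<Sum>k<n. b (k + Suc j)) - (\<Sum>k<n. b k) =
      (b (n + j) - b j) + ((\<Sum>k<n. b (k + j)) - (\<Sum>k<n. b k))"
    unfolding step[symmetric] by simp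
  also have "norm \<dots> \<le> norm (b (n + j) - b j) + norm ((\<Sum>k<n. b (k + j)) - (\<Sum>k<n. b k))"
    by (rule norm_triangle_ineq)
  also have "\<dots> \<le> 2 * C + 2 * real j * C"
    using norm_triangle_ineq4[of "b (n + j)" "b j"] assms[of "n + j"] assms[of j] Suc by linarith
  also have "\<dots> = 2 * real (Suc j) * C" by (simp add: algebra_simps)
  finally show ?case .
qed simp

text \<open>
  The shifts of \<open>a\<close> are uniformly close to finitely many of them, and each of these changes the
  mean of length \<open>n\<close> by \<open>O(1 / n)\<close>; hence for large \<open>n\<close> all shifts have nearly the same mean of length
  \<open>n\<close>. Now take the mean over \<open>j < l\<close> of the means of length \<open>n\<close> of the shifts by \<open>j\<close>. This
  quantity is symmetric in \<open>n\<close> and \<open>l\<close>, and it is near the mean of length \<open>n\<close> as well as near the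
  mean of length \<open>l\<close>.
\<close>

lemma uniformly_Cauchy_on_means:
  fixes a :: "nat \<Rightarrow> 'x \<Rightarrow> 'b::real_normed_field"
  assumes C: "\<And>k x. x \<in> K \<Longrightarrow> norm (a k x) \<le> C"
    and shifts: "\<And>e. e > 0 \<Longrightarrow>
      \<exists>J. \<forall>j. \<exists>i\<le>J. \<forall>k. \<forall>x\<in>K. norm (a (k + j) x - a (k + i) x) < e"
  shows "uniformly_Cauchy_on K (\<lambda>n x. (\<Sum>k<n. a k x) / of_nat n)"
  unfolding uniformly_Cauchy_on_def
proof (intro allI impI)
  fix e :: real assume e: "e > 0"
  obtain J where J: "\<And>j. \<exists>i\<le>J. \<forall>k. \<forall>x\<in>K. norm (a (k + j) x - a (k + i) x) < e / 8"
    using shifts[of "e / 8"] e by auto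
  obtain N where N: "real N > 16 * real J * \<bar>C\<bar> / e" using reals_Archimedean2 by blast
  have close: "norm ((\<Sum>k<n. a (k + j) x) - (\<Sum>k<n. a k x)) \<le> real n * (e / 4)"
    if n: "n \<ge> N" and x: "x \<in> K" for n j x
  proof -
    obtain i where i: "i \<le> J" "\<And>k. norm (a (k + j) x - a (k + i) x) < e / 8" using J x by blast
    have "norm ((\<Sum>k<n. a (k + j) x) - (\<Sum>k<n. a (k + i) x)) \<le> (\<Sum>k<n. e / 8)"
      unfolding sum_subtractf[symmetric] using i(2) by (intro sum_norm_le) (auto intro: less_imp_le)
    moreover have "norm ((\<Sum>k<n. a (k + i) x) - (\<Sum>k<n. a k x)) \<le> 2 * real i * \<bar>C\<bar>"
      using C[OF x] by (intro norm_sum_shift_diff_le) (meson abs_ge_self order_trans)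
    moreover have "2 * real i * \<bar>C\<bar> \<le> real n * (e / 8)"
    proof -
      have "16 * real J * \<bar>C\<bar> < real n * e"
      proof -
        have "16 * real J * \<bar>C\<bar> < real N * e" using N e by (simp add: pos_divide_less_eq)
        also have "\<dots> \<le> real n * e" using n e by (intro mult_right_mono) auto
        finally show ?thesis .
      qed
      moreover have "real i * \<bar>C\<bar> \<le> real J * \<bar>C\<bar>" using i(1) by (intro mult_right_mono) auto
      ultimately show ?thesis by simp
    qed
    ultimately show ?thesis
      using norm_triangle_ineq[of "(\<Sum>k<n. a (k + j) x) - (\<Sum>k<n. a (k + i) x)"
          "(\<Sum>k<n. a (k + i) x) - (\<Sum>k<n. a k x)"] by simp
  qed
  have double: "norm ((\<Sum>j<l. \<Sum>k<n. a (k + j) x) / (of_nat l * of_nat n) -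
      (\<Sum>k<n. a k x) / of_nat n) \<le> e / 4"
    if n: "n \<ge> N" "n > 0" and l: "l > 0" and x: "x \<in> K" for n l x
  proof -
    have "norm (\<Sum>j<l. (\<Sum>k<n. a (k + j) x) - (\<Sum>k<n. a k x)) \<le> (\<Sum>j<l. real n * (e / 4))"
      by (intro sum_norm_le close n x)
    moreover have "(\<Sum>j<l. \<Sum>k<n. a (k + j) x) / (of_nat l * of_nat n) - (\<Sum>k<n. a k x) / of_nat n =
        (\<Sum>j<l. (\<Sum>k<n. a (k + j) x) - (\<Sum>k<n. a k x)) / (of_nat l * of_nat n)"
      using n l by (simp add: sum_subtractf field_simps)
    ultimately show ?thesis using n l by (simp add: norm_divide norm_mult field_simps)
  qed
  have "dist ((\<Sum>k<n. a k x) / of_nat n) ((\<Sum>k<l. a k x) / of_nat l) < e"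
    if n: "n \<ge> Suc N" and l: "l \<ge> Suc N" and x: "x \<in> K" for n l x
  proof -
    let ?W = "(\<Sum>j<l. \<Sum>k<n. a (k + j) x) / (of_nat l * of_nat n)"
    have "?W = (\<Sum>j<n. \<Sum>k<l. a (k + j) x) / (of_nat n * of_nat l)"
      by (subst sum.swap) (simp add: add.commute mult.commute)
    then have "norm (?W - (\<Sum>k<n. a k x) / of_nat n) \<le> e / 4"
      "norm (?W - (\<Sum>k<l. a k x) / of_nat l) \<le> e / 4"
      using double[of n l x] double[of l n x] n l x by simp_all
    then show ?thesis
      using e norm_triangle_ineq4[of "?W - (\<Sum>k<l. a k x) / of_nat l" "?W - (\<Sum>k<n. a k x) / of_nat n"]
      by (simp add: dist_norm)
  qed
  then show "\<exists>M. \<forall>x\<in>K. \<forall>m\<ge>M. \<forall>n\<ge>M.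
      dist ((\<Sum>k<m. a k x) / of_nat m) ((\<Sum>k<n. a k x) / of_nat n) < e"
    by blast
qed

section \<open>Mean ergodicity of composition operators\<close>

lemma composition_operator_funpow:
  "(composition_operator \<phi> ^^ k) p = p \<circ> (\<phi> ^^ k)"
  by (induction k) (auto simp: composition_operator_def fun_eq_iff funpow_swap1)

lemma composition_operator_funpow_hom_polys:
  fixes \<phi> :: "'a::complex_banach \<Rightarrow> 'a"
  assumes "Vector_Spaces.linear scaleC scaleC \<phi>" "continuous_on UNIV \<phi>" "p \<in> hom_polys m"
  shows "p \<circ> (\<phi> ^^ k) \<in> hom_polys m"
proof -
  have "(composition_operator \<phi> ^^ k) p \<in> hom_polys m"
    by (induction k) (simp_all add: composition_operator_hom_polys assms)
  then show ?thesis by (simp only: composition_operator_funpow)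
qed

lemma sum_fun_apply: "(\<Sum>k\<in>A. f k) x = (\<Sum>k\<in>A. f k x)"
  by (induction A rule: infinite_finite_induct) auto

lemma cesaro_mean_composition_operator:
  "cesaro_mean (composition_operator \<phi>) n p = (\<lambda>x. (\<Sum>k<n. p ((\<phi> ^^ k) x)) / of_nat n)"
  by (simp add: cesaro_mean_def composition_operator_funpow sum_fun_apply scaleC_fun_def
      scaleC_complex_def fun_eq_iff)

lemma cesaro_mean_hom_polys:
  assumes "Vector_Spaces.linear scaleC scaleC \<phi>" "continuous_on UNIV \<phi>" "p \<in> hom_polys m"
  shows "cesaro_mean (composition_operator \<phi>) n p \<in> hom_polys m"
  unfolding cesaro_mean_def composition_operator_funpow
  by (intro complex_vector.subspace_scale[OF subspace_hom_polys]
      complex_vector.subspace_sum[OF subspace_hom_polys] composition_operator_funpow_hom_polys assms)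

text \<open>
  Equicontinuity at \<open>0\<close>, expressed by the defining seminorms of the compact-open topology.
\<close>

lemma power_bounded_composition_operatorE:
  assumes pb: "power_bounded (hom_poly_space m) (composition_operator \<phi>)"
    and K: "compact K" and e: "e > 0"
  obtains K' d where "compact K'" "d > 0"
    "\<And>p k x. p \<in> hom_polys m \<Longrightarrow> (\<And>y. y \<in> K' \<Longrightarrow> norm (p y) < d) \<Longrightarrow> x \<in> K \<Longrightarrow>
      norm (p ((\<phi> ^^ k) x)) < e"
proof -
  have "0 \<in> topspace (hom_poly_space m)"
    using complex_vector.subspace_0[OF subspace_hom_polys] by simp
  then obtain U where U: "openin (hom_poly_space m) U" "0 \<in> U"
    and UV: "\<forall>T\<in>range ((^^) (composition_operator \<phi>)). \<forall>p\<in>U.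
      T p - T 0 \<in> {p \<in> hom_polys m. \<forall>x\<in>K. norm (p x) < e}"
    using pb zero_nhds_hom_poly_spaceI[OF K e, of m]
    unfolding power_bounded_def equicontinuous_def by meson
  then have "U \<in> zero_nhds (hom_poly_space m)" by (simp add: zero_nhds_def)
  then obtain K' d where K': "compact K'" "d > 0"
    "\<And>p. p \<in> hom_polys m \<Longrightarrow> (\<And>x. x \<in> K' \<Longrightarrow> norm (p x) < d) \<Longrightarrow> p \<in> U"
    using zero_nhds_hom_poly_space by blast
  have "norm (p ((\<phi> ^^ k) x)) < e"
    if "p \<in> hom_polys m" "\<And>y. y \<in> K' \<Longrightarrow> norm (p y) < d" "x \<in> K" for p k x
  proof -
    have "(composition_operator \<phi> ^^ k) p - (composition_operator \<phi> ^^ k) 0 \<in>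
        {p \<in> hom_polys m. \<forall>x\<in>K. norm (p x) < e}"
      using UV K'(3)[OF that(1,2)] by blast
    then show ?thesis using that(3) by (simp add: composition_operator_funpow)
  qed
  then show ?thesis using that K'(1,2) by blast
qed

lemma tvs_bounded_orbit:
  assumes \<phi>: "Vector_Spaces.linear scaleC scaleC \<phi>" "continuous_on UNIV \<phi>"
    and pb: "power_bounded (hom_poly_space m) (composition_operator \<phi>)"
    and p: "p \<in> hom_polys m"
  shows "tvs_bounded (hom_poly_space m) (range (\<lambda>k. p \<circ> (\<phi> ^^ k)))"
  unfolding tvs_bounded_hom_poly_space_iff
proof (intro conjI allI impI)
  show "range (\<lambda>k. p \<circ> (\<phi> ^^ k)) \<subseteq> hom_polys m"
    using composition_operator_funpow_hom_polys[OF \<phi> p] by blast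
  fix K :: "'a set" assume "compact K"
  then obtain K' d where K': "compact K'" "d > 0"
    "\<And>p k x. p \<in> hom_polys m \<Longrightarrow> (\<And>y. y \<in> K' \<Longrightarrow> norm (p y) < d) \<Longrightarrow> x \<in> K \<Longrightarrow>
      norm (p ((\<phi> ^^ k) x)) < 1"
    using power_bounded_composition_operatorE[OF pb, of K 1] by (metis zero_less_one)
  have "bounded (p ` K')"
    using K'(1) hom_poly_continuous_on[OF p] by (intro compact_imp_bounded compact_continuous_image)
  then obtain M where M: "M > 0" "\<And>y. y \<in> K' \<Longrightarrow> norm (p y) \<le> M"
    by (auto simp: bounded_pos)
  \<comment> \<open>The multiple \<open>c *\<^sub>C p\<close> is so small on \<open>K'\<close> that its whole orbit is bounded by \<open>1\<close> on \<open>K\<close>.\<close>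
  define c where "c = complex_of_real (d / (2 * M))"
  have c: "norm c = d / (2 * M)" "norm c > 0" using M(1) K'(2) by (auto simp: c_def norm_divide)
  have "norm ((p \<circ> (\<phi> ^^ k)) x) \<le> 1 / norm c" if "x \<in> K" for k x
  proof -
    have "norm ((c *\<^sub>C p) y) < d" if "y \<in> K'" for y
    proof -
      have "norm c * norm (p y) \<le> norm c * M" using M(2)[OF that] by (intro mult_left_mono) auto
      also have "\<dots> < d" using c(1) M(1) K'(2) by simp
      finally show ?thesis by (simp add: scaleC_fun_def scaleC_complex_def norm_mult)
    qed
    then have "norm ((c *\<^sub>C p) ((\<phi> ^^ k) x)) < 1"
      using that by (intro K'(3) complex_vector.subspace_scale[OF subspace_hom_polys] p)
    then show ?thesis
      using c(2) by (simp add: scaleC_fun_def scaleC_complex_def norm_mult pos_le_divide_eq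
          mult.commute)
  qed
  then show "\<exists>M. \<forall>q\<in>range (\<lambda>k. p \<circ> (\<phi> ^^ k)). \<forall>x\<in>K. norm (q x) \<le> M" by blast
qed

text \<open>
  The orbit of \<open>p\<close> is bounded, hence has a finite net on the set \<open>K'\<close> that power boundedness
  associates with \<open>K\<close>. If \<open>p \<circ> \<phi> ^^ j\<close> and \<open>p \<circ> \<phi> ^^ i\<close> are close on \<open>K'\<close>, then their compositions
  with all \<open>\<phi> ^^ k\<close> are close on \<open>K\<close>; this is the finiteness of shifts required for convergence
  of the means.
\<close>

lemma uniformly_Cauchy_on_cesaro_means:
  assumes \<phi>: "Vector_Spaces.linear scaleC scaleC \<phi>" "continuous_on UNIV \<phi>"
    and pb: "power_bounded (hom_poly_space m) (composition_operator \<phi>)"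
    and p: "p \<in> hom_polys m" and K: "compact K"
  shows "uniformly_Cauchy_on K (\<lambda>n. cesaro_mean (composition_operator \<phi>) n p)"
proof -
  note orbit = tvs_bounded_orbit[OF \<phi> pb p]
  obtain C where C: "\<And>k x. x \<in> K \<Longrightarrow> norm (p ((\<phi> ^^ k) x)) \<le> C"
    using orbit K unfolding tvs_bounded_hom_poly_space_iff by fastforce
  have shifts: "\<exists>J. \<forall>j. \<exists>i\<le>J. \<forall>k. \<forall>x\<in>K. norm (p ((\<phi> ^^ (k + j)) x) - p ((\<phi> ^^ (k + i)) x)) < e"
    if e: "e > 0" for e :: real
  proof -
    obtain K' d where K': "compact K'" "d > 0"
      "\<And>p k x. p \<in> hom_polys m \<Longrightarrow> (\<And>y. y \<in> K' \<Longrightarrow> norm (p y) < d) \<Longrightarrow> x \<in> K \<Longrightarrow>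
        norm (p ((\<phi> ^^ k) x)) < e"
      using power_bounded_composition_operatorE[OF pb K e] by blast
    obtain F where F: "finite F" "F \<subseteq> range (\<lambda>k. p \<circ> (\<phi> ^^ k))"
      "\<And>q. q \<in> range (\<lambda>k. p \<circ> (\<phi> ^^ k)) \<Longrightarrow> \<exists>r\<in>F. \<forall>x\<in>K'. norm (q x - r x) < d"
      using tvs_bounded_imp_finite_net[OF orbit K'(1,2)] by blast
    obtain I where I: "finite I" "F = (\<lambda>k. p \<circ> (\<phi> ^^ k)) ` I"
      using finite_subset_image[OF F(1,2)] by blast
    have "\<exists>i\<le>Max (insert 0 I). \<forall>k. \<forall>x\<in>K.
        norm (p ((\<phi> ^^ (k + j)) x) - p ((\<phi> ^^ (k + i)) x)) < e" for j
    proof -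
      obtain i where i: "i \<in> I" "\<And>x. x \<in> K' \<Longrightarrow> norm (p ((\<phi> ^^ j) x) - p ((\<phi> ^^ i) x)) < d"
        using F(3)[of "p \<circ> (\<phi> ^^ j)"] unfolding I(2) by auto
      have "norm (p ((\<phi> ^^ (k + j)) x) - p ((\<phi> ^^ (k + i)) x)) < e" if "x \<in> K" for k x
      proof -
        have "norm (((p \<circ> (\<phi> ^^ j)) - (p \<circ> (\<phi> ^^ i))) ((\<phi> ^^ k) x)) < e"
          using i(2) that
          by (intro K'(3) complex_vector.subspace_diff[OF subspace_hom_polys]
              composition_operator_funpow_hom_polys \<phi> p) auto
        moreover have "(\<phi> ^^ (k + l)) x = (\<phi> ^^ l) ((\<phi> ^^ k) x)" for l
          by (simp add: add.commute[of k] funpow_add)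
        ultimately show ?thesis by simp
      qed
      moreover have "i \<le> Max (insert 0 I)" using I(1) i(1) by (intro Max_ge) auto
      ultimately show ?thesis by blast
    qed
    then show ?thesis by blast
  qed
  show ?thesis
    unfolding cesaro_mean_composition_operator by (rule uniformly_Cauchy_on_means[OF C shifts])
qed

lemma norm_cesaro_mean_le:
  assumes "\<And>k. norm (p ((\<phi> ^^ k) x)) \<le> e" "e \<ge> 0"
  shows "norm (cesaro_mean (composition_operator \<phi>) n p x) \<le> e"
proof (cases "n = 0")
  case False
  have "norm (\<Sum>k<n. p ((\<phi> ^^ k) x)) \<le> (\<Sum>k<n. e)" using assms(1) by (intro sum_norm_le)
  then show ?thesis
    using False by (simp add: cesaro_mean_composition_operator norm_divide pos_divide_le_eq mult.commute)
qed (simp add: cesaro_mean_composition_operator assms)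

theorem corollary3p2:
  fixes \<phi> :: "'a::complex_banach \<Rightarrow> 'a" and m :: nat
  assumes "m \<ge> 1"
    and "Vector_Spaces.linear scaleC scaleC \<phi>" and "continuous_on UNIV \<phi>"
    and "power_bounded (hom_poly_space m) (composition_operator \<phi>)"
  shows "uniformly_mean_ergodic (hom_poly_space m) (composition_operator \<phi>)"
proof -
  note \<phi> = assms(2,3) and pb = assms(4)
  let ?A = "cesaro_mean (composition_operator \<phi>)"
  define S where "S p x = lim (\<lambda>n. ?A n p x)" for p x
  have A_hom: "?A n p \<in> hom_polys m" if "p \<in> hom_polys m" for n p
    by (rule cesaro_mean_hom_polys[OF \<phi> that])
  have unif: "uniform_limit K (\<lambda>n. ?A n p) (S p) sequentially"
    if "p \<in> hom_polys m" "compact K" for p K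
    using Cauchy_uniformly_convergent[OF uniformly_Cauchy_on_cesaro_means[OF \<phi> pb that]]
    by (simp add: uniformly_convergent_uniform_limit_iff S_def[abs_def])
  have lim: "(\<lambda>n. ?A n p x) \<longlonglongrightarrow> S p x" if p: "p \<in> hom_polys m" for p x
    using tendsto_uniform_limitI[OF unif[OF p, of "{x}"]] by simp
  have S_le: "norm (S p x) \<le> c"
    if p: "p \<in> hom_polys m" and le: "\<And>k. norm (p ((\<phi> ^^ k) x)) \<le> c" "c \<ge> 0" for p x c
    using norm_cesaro_mean_le[of p \<phi> x c] le
    by (intro Lim_norm_ubound[OF _ lim[OF p]] always_eventually) auto
  have S_hom: "S p \<in> hom_polys m" if p: "p \<in> hom_polys m" for p
  proof (rule hom_polys_pointwise_limit[OF A_hom[OF p] lim[OF p]])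
    show "continuous_on UNIV (S p)"
      by (rule continuous_on_of_uniform_limits_on_compacts
          [OF hom_poly_continuous_on[OF A_hom[OF p]] unif[OF p]])
  qed
  have S_add: "S (p + q) = S p + S q" if p: "p \<in> hom_polys m" and q: "q \<in> hom_polys m" for p q
  proof
    fix x
    have "(\<lambda>n. ?A n p x + ?A n q x) \<longlonglongrightarrow> S p x + S q x"
      by (intro tendsto_add lim p q)
    then have "(\<lambda>n. ?A n (p + q) x) \<longlonglongrightarrow> S p x + S q x"
      by (simp add: cesaro_mean_composition_operator sum.distrib add_divide_distrib)
    then show "S (p + q) x = (S p + S q) x"
      using LIMSEQ_unique[OF lim] complex_vector.subspace_add[OF subspace_hom_polys p q] by simp
  qed
  have S_scale: "S (c *\<^sub>C p) = c *\<^sub>C S p" if p: "p \<in> hom_polys m" for c p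
  proof
    fix x
    have "(\<lambda>n. c * ?A n p x) \<longlonglongrightarrow> c * S p x"
      by (intro tendsto_mult tendsto_const lim p)
    then have "(\<lambda>n. ?A n (c *\<^sub>C p) x) \<longlonglongrightarrow> c * S p x"
      by (simp add: cesaro_mean_composition_operator scaleC_fun_def scaleC_complex_def
          sum_distrib_left[symmetric])
    then show "S (c *\<^sub>C p) x = (c *\<^sub>C S p) x"
      using LIMSEQ_unique[OF lim] complex_vector.subspace_scale[OF subspace_hom_polys p]
      by (simp add: scaleC_fun_def scaleC_complex_def)
  qed
  have S_diff: "S (p - q) = S p - S q" if p: "p \<in> hom_polys m" and q: "q \<in> hom_polys m" for p q
    using S_add[OF complex_vector.subspace_diff[OF subspace_hom_polys p q] q] by (simp add: algebra_simps)
  \<comment> \<open>The estimate that power boundedness gives for the iterates passes to their means and to \<open>S\<close>.\<close>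
  have S_cont: "continuous_map (hom_poly_space m) (hom_poly_space m) S"
    unfolding continuous_map_def topspace_hom_poly_space
  proof (intro conjI allI impI)
    show "S \<in> hom_polys m \<rightarrow> hom_polys m" using S_hom by blast
    fix U :: "('a \<Rightarrow> complex) set" assume U: "openin (hom_poly_space m) U"
    show "openin (hom_poly_space m) {p \<in> hom_polys m. S p \<in> U}"
      unfolding hom_poly_space_def openin_compact_open_topology
    proof (intro conjI ballI)
      fix p assume p: "p \<in> {p \<in> hom_polys m. S p \<in> U}"
      then obtain K e where K: "compact K" "e > 0"
        "{q \<in> hom_polys m. \<forall>x\<in>K. dist (q x) (S p x) < e} \<subseteq> U"
        using U unfolding hom_poly_space_def openin_compact_open_topology by blast
      obtain K' d where K': "compact K'" "d > 0"
        "\<And>p k x. p \<in> hom_polys m \<Longrightarrow> (\<And>y. y \<in> K' \<Longrightarrow> norm (p y) < d) \<Longrightarrow> x \<in> K \<Longrightarrow>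
          norm (p ((\<phi> ^^ k) x)) < e / 2"
        using power_bounded_composition_operatorE[OF pb K(1), of "e / 2"] K(2)
        by (metis half_gt_zero)
      have "S q \<in> U" if q: "q \<in> hom_polys m" "\<forall>x\<in>K'. dist (q x) (p x) < d" for q
      proof -
        have qp: "q - p \<in> hom_polys m"
          using p q(1) by (intro complex_vector.subspace_diff[OF subspace_hom_polys]) auto
        have "dist (S q x) (S p x) < e" if x: "x \<in> K" for x
        proof -
          have "norm (S (q - p) x) \<le> e / 2"
            using K'(3)[OF qp _ x] q(2) K(2) by (intro S_le[OF qp] less_imp_le) (auto simp: dist_norm)
          then show ?thesis
            using S_diff[OF q(1), of p] p K(2) by (simp add: dist_norm)
        qed
        then show ?thesis using K(3) S_hom[OF q(1)] by blast
      qed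
      then show "\<exists>K e. compact K \<and> e > 0 \<and> {q \<in> hom_polys m. \<forall>x\<in>K. dist (q x) (p x) < e}
          \<subseteq> {p \<in> hom_polys m. S p \<in> U}"
        using K'(1,2) by blast
    qed blast
  qed
  have "S \<in> continuous_operators (hom_poly_space m)"
    unfolding continuous_operators_def using S_cont S_add S_scale by simp
  moreover have "converges_bounded_uniformly (hom_poly_space m) ?A S"
    unfolding converges_bounded_uniformly_def
  proof (intro allI impI ballI)
    fix B V :: "('a \<Rightarrow> complex) set"
    assume B: "tvs_bounded (hom_poly_space m) B" and V: "V \<in> zero_nhds (hom_poly_space m)"
    then have sub: "B \<subseteq> hom_polys m" by (simp add: tvs_bounded_hom_poly_space_iff)
    obtain K e where K: "compact K" "e > 0"
      "\<And>p. p \<in> hom_polys m \<Longrightarrow> (\<And>x. x \<in> K \<Longrightarrow> norm (p x) < e) \<Longrightarrow> p \<in> V"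
      using zero_nhds_hom_poly_space[OF V] by blast
    obtain K' d where K': "compact K'" "d > 0"
      "\<And>p k x. p \<in> hom_polys m \<Longrightarrow> (\<And>y. y \<in> K' \<Longrightarrow> norm (p y) < d) \<Longrightarrow> x \<in> K \<Longrightarrow>
        norm (p ((\<phi> ^^ k) x)) < e / 4"
      using power_bounded_composition_operatorE[OF pb K(1), of "e / 4"] K(2)
      by (metis divide_pos_pos zero_less_numeral)
    obtain F where F: "finite F" "F \<subseteq> B" "\<And>p. p \<in> B \<Longrightarrow> \<exists>q\<in>F. \<forall>x\<in>K'. norm (p x - q x) < d"
      using tvs_bounded_imp_finite_net[OF B K'(1,2)] by blast
    \<comment> \<open>On the finite net convergence is uniform, and by the choice of \<open>K'\<close> and \<open>d\<close> replacing
      \<open>p \<in> B\<close> by a nearby \<open>q \<in> F\<close> changes each mean and its limit by at most \<open>e / 4\<close> on \<open>K\<close>.\<close>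
    have "\<forall>\<^sub>F n in sequentially. \<forall>x\<in>K. dist (?A n q x) (S q x) < e / 4" if "q \<in> F" for q
    proof -
      have q: "q \<in> hom_polys m" using that F(2) sub by blast
      show ?thesis using uniform_limitD[OF unif[OF q K(1)], of "e / 4"] K(2) by simp
    qed
    then have "\<forall>\<^sub>F n in sequentially. \<forall>q\<in>F. \<forall>x\<in>K. dist (?A n q x) (S q x) < e / 4"
      using F(1) by (simp add: eventually_ball_finite)
    then show "\<forall>\<^sub>F n in sequentially. \<forall>p\<in>B. ?A n p - S p \<in> V"
    proof eventually_elim
      case (elim n)
      show ?case
      proof
        fix p assume pB: "p \<in> B"
        then have p: "p \<in> hom_polys m" using sub by blast
        obtain q where q: "q \<in> F" "\<And>x. x \<in> K' \<Longrightarrow> norm (p x - q x) < d" using F(3)[OF pB] by blast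
        have q': "q \<in> hom_polys m" using q(1) F(2) sub by blast
        have pq: "p - q \<in> hom_polys m"
          by (rule complex_vector.subspace_diff[OF subspace_hom_polys p q'])
        show "?A n p - S p \<in> V"
        proof (rule K(3))
          show "?A n p - S p \<in> hom_polys m"
            by (intro complex_vector.subspace_diff[OF subspace_hom_polys] A_hom S_hom p)
          fix x assume x: "x \<in> K"
          have small: "norm ((p - q) ((\<phi> ^^ k) x)) \<le> e / 4" for k
            using K'(3)[OF pq _ x] q(2) by (intro less_imp_le) auto
          have "norm (?A n (p - q) x) \<le> e / 4" "norm (S (p - q) x) \<le> e / 4"
            using K(2) by (intro norm_cesaro_mean_le S_le[OF pq] small; simp)+
          moreover have "norm (?A n q x - S q x) < e / 4"
            using bspec[OF bspec[OF elim q(1)] x] by (simp only: dist_norm)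
          ultimately have "norm (?A n (p - q) x + (?A n q x - S q x) - S (p - q) x) < e"
            using K(2) norm_triangle_ineq[of "?A n (p - q) x" "?A n q x - S q x"]
              norm_triangle_ineq4[of "?A n (p - q) x + (?A n q x - S q x)" "S (p - q) x"]
            by linarith
          moreover have "(?A n p - S p) x = ?A n (p - q) x + (?A n q x - S q x) - S (p - q) x"
            using S_diff[OF p q']
            by (simp add: cesaro_mean_composition_operator sum_subtractf diff_divide_distrib)
          ultimately show "norm ((?A n p - S p) x) < e" by (simp only:)
        qed
      qed
    qed
  qed
  ultimately show ?thesis unfolding uniformly_mean_ergodic_def by blast
qed

end
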